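(* Let $A,C,Q\in\mathbb{R}^{n\times n}$, $B,N\in\mathbb{R}^{n\times m}$, $R\in\mathbb{R}^{m\times m}$, $b,\lambda\in\mathbb{R}^n$, with $Q$ symmetric positive-semidefinite and $R$ symmetric positive-definite. Let $\tilde Q=Q-NR^{-1}N^\top$, $\tilde A=A-BR^{-1}N^\top$, $\tilde R=BR^{-1}B^\top$ and $$H(x,p)=\tfrac12x^\top\tilde Qx+p^\top\tilde Ax-\tfrac12p^\top\tilde Rp+p^\top b.$$ For a pre-reset state $x=x^-\in\Sigma$ and a post-reset co-state $p=p^+\in\mathbb{R}^n$ put $$\alpha=-\tfrac12\lambda^\top\tilde R\lambda,\qquad \beta=\lambda^\top\left[\tilde Ax-\tilde RC^\top p\right]+\lambda^\top b,\qquad \gamma=H(x,C^\top p)-H(Cx,p),$$ and let $\mathcal{D}=\beta^2-4\alpha\gamma$. Suppose the system has strongly actuated resets, i.e. $\alpha\neq0$, and that the multiplier $\varepsilon\in\mathbb{R}$ and $p^-$ satisfy the co-state jump conditions $$p^-=C^\top p+\varepsilon\lambda,\qquad H(x,p^-)=H(Cx,p).$$ Then $|\lambda^\top\dot x^-|=|\sqrt{\mathcal{D}}|$, where $\dot x^-=\tilde Ax-\tilde Rp^-+b$ is the state velocity immediately before the reset.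
   Context: The setting is the affine quadratic regulator for the hybrid control system $\dot x=Ax+Bu+b$ for $x\notin\Sigma$, $x^+=Cx$ for $x\in\Sigma$, with spatial guard $\Sigma=\{x:\lambda^\top x=a\}$ (or $\Sigma=\{x:\lambda^\top x=a,\ \nu^\top x<d\}$) and running cost $\frac12(x^\top Qx+u^\top Ru+2x^\top Nu)$. Between resets, states and co-states satisfy $\dot x=\tilde Ax-\tilde Rp+b$, $\dot p=-\tilde Qx-\tilde A^\top p$. Energy conservation at a reset is equivalent to $\alpha\varepsilon^2+\beta\varepsilon+\gamma=0$. *)

theory Defs
  imports "HOL-Analysis.Analysis"
begin

definition symmetric_matrix :: "real ^ 'k ^ 'k \<Rightarrow> bool" where
  "symmetric_matrix M \<longleftrightarrow> transpose M = M"

definition pos_semidef :: "real ^ 'k ^ 'k \<Rightarrow> bool" where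
  "pos_semidef M \<longleftrightarrow> (\<forall>v. 0 \<le> v \<bullet> (M *v v))"

definition pos_def :: "real ^ 'k ^ 'k \<Rightarrow> bool" where
  "pos_def M \<longleftrightarrow> (\<forall>v. v \<noteq> 0 \<longrightarrow> 0 < v \<bullet> (M *v v))"

definition plane_guard :: "real ^ 'n \<Rightarrow> real \<Rightarrow> (real ^ 'n) set" where
  "plane_guard l a = {x. l \<bullet> x = a}"

definition half_plane_guard ::
    "real ^ 'n \<Rightarrow> real \<Rightarrow> real ^ 'n \<Rightarrow> real \<Rightarrow> (real ^ 'n) set" where
  "half_plane_guard l a \<nu> d = {x. l \<bullet> x = a \<and> \<nu> \<bullet> x < d}"

text \<open>
  The matrices obtained by eliminating the optimal control
  \<open>u = - R\<^sup>-\<^sup>1 (N\<^sup>T x + B\<^sup>T p)\<close>.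
  An \<open>n \<times> m\<close> matrix has type \<open>real ^ 'm ^ 'n\<close>.
\<close>

definition tilde_Q ::
    "real ^ 'n ^ 'n \<Rightarrow> real ^ 'm ^ 'n \<Rightarrow> real ^ 'm ^ 'm \<Rightarrow> real ^ 'n ^ 'n" where
  "tilde_Q Q N R = Q - N ** matrix_inv R ** transpose N"

definition tilde_A ::
    "real ^ 'n ^ 'n \<Rightarrow> real ^ 'm ^ 'n \<Rightarrow> real ^ 'm ^ 'n \<Rightarrow> real ^ 'm ^ 'm \<Rightarrow> real ^ 'n ^ 'n" where
  "tilde_A A B N R = A - B ** matrix_inv R ** transpose N"

definition tilde_R :: "real ^ 'm ^ 'n \<Rightarrow> real ^ 'm ^ 'm \<Rightarrow> real ^ 'n ^ 'n" where
  "tilde_R B R = B ** matrix_inv R ** transpose B"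

text \<open>
  The definitions below are stated for the reduced matrices
  \<open>Qt = tilde_Q Q N R\<close>, \<open>At = tilde_A A B N R\<close>, \<open>Rt = tilde_R B R\<close>.
\<close>

definition hamiltonian ::
    "real ^ 'n ^ 'n \<Rightarrow> real ^ 'n ^ 'n \<Rightarrow> real ^ 'n ^ 'n \<Rightarrow> real ^ 'n \<Rightarrow>
     real ^ 'n \<Rightarrow> real ^ 'n \<Rightarrow> real" where
  "hamiltonian Qt At Rt b x p =
     1/2 * (x \<bullet> (Qt *v x)) + p \<bullet> (At *v x) - 1/2 * (p \<bullet> (Rt *v p)) + p \<bullet> b"

definition state_velocity ::
    "real ^ 'n ^ 'n \<Rightarrow> real ^ 'n ^ 'n \<Rightarrow> real ^ 'n \<Rightarrow> real ^ 'n \<Rightarrow> real ^ 'n \<Rightarrow> real ^ 'n" where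
  "state_velocity At Rt b x p = At *v x - Rt *v p + b"

end

theory Submission
  imports Defs
begin

text \<open>
  The Hamiltonian is quadratic in the co-state with symmetric Hessian \<open>- Rt\<close>, so along
  \<open>p\<^sup>- = C\<^sup>T p + \<epsilon> l\<close> energy conservation reads \<open>\<alpha> \<epsilon>\<^sup>2 + \<beta> \<epsilon> + \<gamma> = 0\<close>, while the normal
  velocity \<open>l \<bullet> \<partial>H/\<partial>p\<close> is the derivative \<open>2 \<alpha> \<epsilon> + \<beta>\<close> of this polynomial. At a root, the square
  of the derivative of a quadratic polynomial is its discriminant.
\<close>

lemma pos_def_invertible:
  assumes "pos_def (R :: real ^ 'm ^ 'm)"
  shows "invertible R"
proof -
  have "v = 0" if "R *v v = 0" for v
    using assms that unfolding pos_def_def by (metis inner_zero_right less_irrefl)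
  then show ?thesis
    by (simp add: invertible_left_inverse matrix_left_invertible_ker)
qed

text \<open>Transposing \<open>R ** matrix_inv R = mat 1\<close> makes the transposed inverse a left
  inverse of \<open>R\<close>, and a left inverse must agree with a right inverse.\<close>

lemma symmetric_matrix_inv:
  assumes "symmetric_matrix (R :: real ^ 'm ^ 'm)" and "invertible R"
  shows "symmetric_matrix (matrix_inv R)"
proof -
  have inv: "R ** matrix_inv R = mat 1"
    using someI_ex[OF \<open>invertible R\<close>[unfolded invertible_def]]
    by (simp add: matrix_inv_def)
  have "transpose (matrix_inv R) ** R = transpose (R ** matrix_inv R)"
    using assms(1) by (simp add: matrix_transpose_mul symmetric_matrix_def)
  then have left: "transpose (matrix_inv R) ** R = mat 1"
    by (simp add: inv transpose_mat)
  have "transpose (matrix_inv R) = (transpose (matrix_inv R) ** R) ** matrix_inv R"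
    by (simp add: inv flip: matrix_mul_assoc)
  then show ?thesis
    by (simp add: left symmetric_matrix_def)
qed

lemma symmetric_tilde_R:
  assumes "symmetric_matrix R" and "pos_def R"
  shows "symmetric_matrix (tilde_R B R)"
  using symmetric_matrix_inv[OF assms(1) pos_def_invertible[OF assms(2)]]
  by (simp add: symmetric_matrix_def tilde_R_def matrix_transpose_mul matrix_mul_assoc)

lemma inner_symmetric_matrix:
  assumes "symmetric_matrix M"
  shows "u \<bullet> (M *v v) = v \<bullet> (M *v u)"
  using assms by (metis dot_lmul_matrix inner_commute symmetric_matrix_def transpose_matrix_vector)

text \<open>An exact second-order Taylor expansion in the co-state; symmetry of \<open>Rt\<close>
  merges the two cross terms between \<open>q\<close> and \<open>l\<close>.\<close>

lemma hamiltonian_shift: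
  assumes "symmetric_matrix Rt"
  shows "hamiltonian Qt At Rt b x (q + \<epsilon> *\<^sub>R l) =
    hamiltonian Qt At Rt b x q + (l \<bullet> (At *v x - Rt *v q) + l \<bullet> b) * \<epsilon>
      - 1/2 * (l \<bullet> (Rt *v l)) * \<epsilon>\<^sup>2"
  using inner_symmetric_matrix[OF assms, of q l]
  by (simp add: hamiltonian_def matrix_vector_right_distrib matrix_vector_mult_scaleR
      inner_add_left inner_add_right inner_diff_right power2_eq_square field_simps)

text \<open>The two sides differ by 4 \<alpha> times the polynomial.\<close>

lemma quadratic_derivative_at_root:
  fixes \<alpha> \<beta> \<gamma> z :: real
  assumes "\<alpha> * z\<^sup>2 + \<beta> * z + \<gamma> = 0"
  shows "(2 * \<alpha> * z + \<beta>)\<^sup>2 = \<beta>\<^sup>2 - 4 * \<alpha> * \<gamma>"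
  using assms by algebra

theorem proposition12:
  fixes A C Q Qt At Rt :: "real ^ 'n ^ 'n"
    and B N :: "real ^ 'm ^ 'n"
    and R :: "real ^ 'm ^ 'm"
    and b l \<nu> x p p_minus :: "real ^ 'n"
    and a d \<alpha> \<beta> \<gamma> D \<epsilon> :: real
    and \<Sigma> :: "(real ^ 'n) set"
    and H :: "real ^ 'n \<Rightarrow> real ^ 'n \<Rightarrow> real"
  assumes "symmetric_matrix Q" and "pos_semidef Q"
    and "symmetric_matrix R" and "pos_def R"
    and "Qt = tilde_Q Q N R"
    and "At = tilde_A A B N R"
    and "Rt = tilde_R B R"
    and "H = hamiltonian Qt At Rt b"
    and "\<Sigma> = plane_guard l a \<or> \<Sigma> = half_plane_guard l a \<nu> d"
    and "x \<in> \<Sigma>"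
    and "\<alpha> = - (1/2) * (l \<bullet> (Rt *v l))"
    and "\<beta> = l \<bullet> (At *v x - Rt *v (transpose C *v p)) + l \<bullet> b"
    and "\<gamma> = H x (transpose C *v p) - H (C *v x) p"
    and "D = \<beta>\<^sup>2 - 4 * \<alpha> * \<gamma>"
    and "\<alpha> \<noteq> 0"
    and "p_minus = transpose C *v p + \<epsilon> *\<^sub>R l"
    and "H x p_minus = H (C *v x) p"
  shows "\<bar>l \<bullet> state_velocity At Rt b x p_minus\<bar> = \<bar>sqrt D\<bar>"
proof -
  have sym: "symmetric_matrix Rt"
    using assms symmetric_tilde_R by blast
  \<comment> \<open>Expand around \<open>transpose C *v p\<close>; \<gamma> is the energy mismatch
    there, at \<epsilon> = 0.\<close>
  have "\<alpha> * \<epsilon>\<^sup>2 + \<beta> * \<epsilon> + \<gamma> = 0"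
    using \<open>H x p_minus = H (C *v x) p\<close>
    unfolding assms(8,11-13,16) hamiltonian_shift[OF sym] by simp
  then have "(2 * \<alpha> * \<epsilon> + \<beta>)\<^sup>2 = D"
    using \<open>D = \<beta>\<^sup>2 - 4 * \<alpha> * \<gamma>\<close> quadratic_derivative_at_root by blast
  \<comment> \<open>The shift by \<open>\<epsilon> *\<^sub>R l\<close> contributes
    \<open>- \<epsilon> * (l \<bullet> (Rt *v l))\<close>, which is 2 \<alpha> \<epsilon>.\<close>
  moreover have "l \<bullet> state_velocity At Rt b x p_minus = 2 * \<alpha> * \<epsilon> + \<beta>"
    unfolding assms(11,12,16) state_velocity_def
    by (simp add: matrix_vector_right_distrib matrix_vector_mult_scaleR
        inner_add_right inner_diff_right)
  ultimately show ?thesis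
    by (metis abs_idempotent real_sqrt_abs)
qed

end
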